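(* There exists a continuous, $1$-periodic function $\psi:\mathbb R\rightarrow\mathbb R$ such that for all integers $N\geq 1$ \[\frac 1N S(N)=\frac{\log_2 N}{4}+\frac{d_N}{2N}+\psi(\log_2 N).\] The function $\psi$ (continuous, $1$-periodic, with this property) is uniquely determined.
   Context: Here $\log_2$ is the logarithm in base $2$. Every nonnegative integer $n$ has a unique binary expansion $n=\sum_{i=0}^{\nu}\varepsilon_i(n)2^i$ with $\varepsilon_i(n)\in\{0,1\}$ and ($\nu=0$ or $\varepsilon_\nu(n)\neq 0$). The Van der Corput sequence in base $2$ is $\omega=(\omega_n)_{n\geq 0}$ with $\omega_n=\sum_{i=0}^{\nu}\varepsilon_i(n)2^{-i-1}$. For a sequence $x=(x_n)_{n\geq 0}$ in $[0,1)$ and an integer $N\geq 1$, the discrepancy is $D_N(x)=\sup_{0\leq a\leq b\leq 1}\left|\frac{A_N(x,a,b)}{N}-(b-a)\right|$, where $A_N(x,a,b)=|\{0\leq n<N: a\leq x_n<b\}|$; moreover $D_0(x)=0$. Set $d_N=N D_N(\omega)$ for $N\geq 0$, and $S(N)=d_1+\cdots+d_N$. *)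

theory Defs
  imports "HOL-Analysis.Analysis"
begin

definition bin_digit :: "nat \<Rightarrow> nat \<Rightarrow> nat" where
  "bin_digit i n = (n div 2 ^ i) mod 2"

definition bin_top :: "nat \<Rightarrow> nat" where
  "bin_top n = (LEAST m. n < 2 ^ Suc m)"

text \<open>The next lemmas confirm that \<open>bin_digit\<close> and \<open>bin_top\<close> give the unique binary expansion
  with nonzero leading digit (or top index 0).\<close>

lemma sum_bin_digit: "(\<Sum>i<k. bin_digit i n * 2 ^ i) = n mod 2 ^ k"
proof (induction k)
  case (Suc k)
  have "n mod 2 ^ Suc k = 2 ^ k * (n div 2 ^ k mod 2) + n mod 2 ^ k"
    using mod_mult2_eq[of n "2 ^ k" 2] by (simp add: mult.commute)
  then show ?case using Suc by (simp add: bin_digit_def mult.commute)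
qed simp

lemma less_bin_top: "n < 2 ^ Suc (bin_top n)"
  unfolding bin_top_def
  by (rule LeastI[of _ n]) (metis less_exp lessI less_trans)

lemma bin_expansion:
  "n = (\<Sum>i\<le>bin_top n. bin_digit i n * 2 ^ i)"
  "bin_digit i n \<in> {0, 1}"
  "bin_top n = 0 \<or> bin_digit (bin_top n) n \<noteq> 0"
proof -
  show "n = (\<Sum>i\<le>bin_top n. bin_digit i n * 2 ^ i)"
    using sum_bin_digit[of n "Suc (bin_top n)"] less_bin_top[of n]
    by (simp add: lessThan_Suc_atMost del: sum.lessThan_Suc)
  show "bin_digit i n \<in> {0, 1}" by (auto simp: bin_digit_def)
  show "bin_top n = 0 \<or> bin_digit (bin_top n) n \<noteq> 0"
  proof (cases "bin_top n")
    case (Suc k)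
    have "\<not> n < 2 ^ Suc k"
      using not_less_Least[of k "\<lambda>m. n < 2 ^ Suc m"] Suc by (simp add: bin_top_def)
    moreover have "n < 2 ^ Suc (Suc k)" using less_bin_top[of n] Suc by simp
    ultimately have "n div 2 ^ Suc k = 1"
      by (intro div_nat_eqI) auto
    then show ?thesis using Suc by (simp add: bin_digit_def)
  qed simp
qed

lemma sum_digits_less:
  fixes e :: "nat \<Rightarrow> nat"
  assumes "\<And>i. i < k \<Longrightarrow> e i \<in> {0, 1}"
  shows "(\<Sum>i<k. e i * 2 ^ i) < 2 ^ k"
  using assms
proof (induction k)
  case (Suc k)
  have "(\<Sum>i<k. e i * 2 ^ i) < 2 ^ k" using Suc by simp
  moreover have "e k \<le> 1" using Suc.prems[of k] by auto
  then have "e k * 2 ^ k \<le> 2 ^ k" by simp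
  ultimately have "(\<Sum>i<k. e i * 2 ^ i) + e k * 2 ^ k < 2 ^ k + 2 ^ k"
    by (rule add_less_le_mono)
  then show ?case by simp
qed simp

lemma bin_expansion_unique:
  fixes e :: "nat \<Rightarrow> nat"
  assumes n: "n = (\<Sum>i\<le>m. e i * 2 ^ i)"
    and e: "\<And>i. i \<le> m \<Longrightarrow> e i \<in> {0, 1}"
    and top: "m = 0 \<or> e m \<noteq> 0"
  shows "m = bin_top n" and "i \<le> m \<Longrightarrow> e i = bin_digit i n"
proof -
  have n': "n = (\<Sum>i<Suc m. e i * 2 ^ i)" using n by (simp add: lessThan_Suc_atMost)
  have lt: "n < 2 ^ Suc m"
    unfolding n' by (rule sum_digits_less) (use e in auto)
  show "m = bin_top n"
    unfolding bin_top_def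
  proof (rule sym, rule Least_equality)
    show "n < 2 ^ Suc m" by (rule lt)
    fix k assume k: "n < 2 ^ Suc k"
    show "m \<le> k"
    proof (rule ccontr)
      assume "\<not> m \<le> k"
      then have km: "Suc k \<le> m" by simp
      then have "e m \<ge> 1" using top by auto
      then have "2 ^ m \<le> e m * 2 ^ m" by simp
      also have "\<dots> \<le> n" by (simp add: n')
      finally have "2 ^ m \<le> n" .
      moreover have "(2::nat) ^ Suc k \<le> 2 ^ m" using km by (intro power_increasing) auto
      ultimately show False using k by linarith
    qed
  qed
  assume i: "i \<le> m"
  define L where "L = (\<Sum>j<i. e j * 2 ^ j)"
  define R where "R = (\<Sum>j\<in>{Suc i..<Suc m}. e j * 2 ^ (j - Suc i))"
  have L: "L < 2 ^ i" unfolding L_def by (rule sum_digits_less) (use e i in auto)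
  have "n = L + (\<Sum>j\<in>{i..<Suc m}. e j * 2 ^ j)"
    unfolding n' L_def lessThan_atLeast0 using i
    by (simp only: sum.atLeastLessThan_concat le_SucI)
  also have "(\<Sum>j\<in>{i..<Suc m}. e j * 2 ^ j)
      = e i * 2 ^ i + (\<Sum>j\<in>{Suc i..<Suc m}. e j * 2 ^ j)"
    using i by (subst sum.atLeast_Suc_lessThan) auto
  also have "(\<Sum>j\<in>{Suc i..<Suc m}. e j * 2 ^ j) = 2 ^ Suc i * R"
    unfolding R_def sum_distrib_left
  proof (rule sum.cong[OF refl])
    fix j assume "j \<in> {Suc i..<Suc m}"
    then have "(2::nat) ^ j = 2 ^ Suc i * 2 ^ (j - Suc i)"
      by (subst power_add[symmetric]) simp
    then show "e j * 2 ^ j = 2 ^ Suc i * (e j * 2 ^ (j - Suc i))" by simp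
  qed
  finally have "n = L + 2 ^ i * (e i + 2 * R)" by (simp add: algebra_simps)
  then have "n div 2 ^ i = e i + 2 * R" using L by simp
  moreover have "e i \<in> {0, 1}" using e i by simp
  ultimately show "e i = bin_digit i n" by (auto simp: bin_digit_def)
qed

definition van_der_corput :: "nat \<Rightarrow> real" where
  "van_der_corput n = (\<Sum>i\<le>bin_top n. real (bin_digit i n) / 2 ^ (i + 1))"

definition count_in :: "(nat \<Rightarrow> real) \<Rightarrow> nat \<Rightarrow> real \<Rightarrow> real \<Rightarrow> nat" where
  "count_in x N a b = card {n. n < N \<and> a \<le> x n \<and> x n < b}"

definition discrepancy :: "(nat \<Rightarrow> real) \<Rightarrow> nat \<Rightarrow> real" where
  "discrepancy x N =
    (if N = 0 then 0
     else (SUP (a, b) \<in> {(a, b). 0 \<le> a \<and> a \<le> b \<and> b \<le> 1}.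
             \<bar>real (count_in x N a b) / real N - (b - a)\<bar>))"

text \<open>The supremum on the reals is only meaningful for nonempty sets that are bounded above;
  nonemptiness is clear, and boundedness is the following fact.\<close>

lemma bdd_above_discrepancy:
  "bdd_above ((\<lambda>(a, b). \<bar>real (count_in x N a b) / real N - (b - a)\<bar>) `
    {(a, b). 0 \<le> a \<and> a \<le> b \<and> b \<le> 1})"
proof (rule bdd_aboveI2)
  fix p :: "real \<times> real"
  assume p: "p \<in> {(a, b). 0 \<le> a \<and> a \<le> b \<and> b \<le> 1}"
  obtain a b where ab: "p = (a, b)" by (cases p)
  have "count_in x N a b \<le> card {..<N}"
    unfolding count_in_def by (rule card_mono) auto
  then have "real (count_in x N a b) / real N \<le> 1"
    by (simp add: divide_le_eq)
  moreover have "0 \<le> real (count_in x N a b) / real N" by simp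
  ultimately show "(case p of (a, b) \<Rightarrow> \<bar>real (count_in x N a b) / real N - (b - a)\<bar>) \<le> 1"
    using p ab unfolding abs_le_iff by (simp, linarith)
qed

definition vdc_d :: "nat \<Rightarrow> real" where
  "vdc_d N = real N * discrepancy van_der_corput N"

definition vdc_S :: "nat \<Rightarrow> real" where
  "vdc_S N = (\<Sum>k = 1..N. vdc_d k)"

end

theory Submission
  imports Defs
begin

text \<open>Let \<open>\<parallel>y\<parallel>\<close> be the distance from \<open>y\<close> to the nearest integer. The digit recursion of
  the sequence gives \<open>d(2N) = d(N)\<close> and \<open>d(2N+1) = (d(N) + d(N+1) + 1) / 2\<close>, and these
  are also satisfied by \<open>\<Sum>i\<ge>1. \<parallel>N / 2^i\<parallel>\<close>. Hence \<open>E(N) = S(N) - d(N) / 2\<close>, a trapezoidal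
  sum of \<open>d\<close>, equals \<open>\<Sum>i\<ge>1. 2^i P(N / 2^i)\<close>, where \<open>P\<close> is the primitive of \<open>\<parallel>\<cdot>\<parallel>\<close> with
  \<open>P(0) = 0\<close>. Write \<open>P(y) = y / 4 + p(y)\<close> with \<open>p\<close> of period \<open>1\<close>. Adding
  \<open>\<Sum>i\<ge>0. p(2^i x) / 2^i\<close>, which vanishes at integers \<open>x\<close>, extends \<open>E\<close> to a continuous
  function \<open>G\<close> on the nonnegative reals with \<open>G(2x) = 2 G(x) + x / 2\<close>; then
  \<open>\<psi>(t) = G(2^t) / 2^t - t / 4\<close>. Uniqueness holds because the fractional parts of
  \<open>log 2 N\<close> are dense.\<close>

subsection \<open>The discrepancy recursion\<close>

text \<open>Digits above the top one vanish, so every long enough index range gives the same sum;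
  this lets \<open>n\<close> and \<open>2 * n + b\<close> be compared digit by digit.\<close>

lemma vdc_eq_sum:
  assumes "n < 2 ^ k"
  shows "van_der_corput n = (\<Sum>i<k. real (bin_digit i n) / 2 ^ (i + 1))"
proof -
  have digit0: "bin_digit i n = 0" if "n < 2 ^ m" "m \<le> i" for i m
  proof -
    have "(2::nat) ^ m \<le> 2 ^ i" using that by (intro power_increasing) auto
    then have "n < 2 ^ i" using that(1) by (rule less_le_trans[rotated])
    then show ?thesis by (simp add: bin_digit_def)
  qed
  let ?g = "\<lambda>i. real (bin_digit i n) / 2 ^ (i + 1)"
  let ?t = "Suc (bin_top n)"
  have "sum ?g {..<?t} = sum ?g {..<max k ?t}"
    by (rule sum.mono_neutral_left) (use digit0[OF less_bin_top] in auto)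
  moreover have "sum ?g {..<k} = sum ?g {..<max k ?t}"
    by (rule sum.mono_neutral_left) (use digit0[OF assms] in auto)
  ultimately show ?thesis
    unfolding van_der_corput_def by (simp add: lessThan_Suc_atMost)
qed

text \<open>A new lowest digit pushes every other digit one binary place further right in the
  radical inverse and itself takes the leading place.\<close>

lemma vdc_double_add:
  assumes "b < 2"
  shows "van_der_corput (2 * n + b) = van_der_corput n / 2 + real b / 2"
proof -
  have n: "n < 2 ^ n" by (rule less_exp)
  have digit: "bin_digit (Suc i) (2 * n + b) = bin_digit i n" for i
  proof -
    have "(2 * n + b) div 2 = n" using assms by simp
    then show ?thesis by (simp add: bin_digit_def div_mult2_eq)
  qed
  have "2 * n + b < 2 ^ Suc n" using n assms unfolding power_Suc by linarith
  then have "van_der_corput (2 * n + b)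
      = (\<Sum>i<Suc n. real (bin_digit i (2 * n + b)) / 2 ^ (i + 1))"
    by (rule vdc_eq_sum)
  also have "\<dots> = real (bin_digit 0 (2 * n + b)) / 2
      + (\<Sum>i<n. real (bin_digit (Suc i) (2 * n + b)) / 2 ^ (i + 1) / 2)"
    unfolding sum.lessThan_Suc_shift by (simp add: field_simps)
  also have "bin_digit 0 (2 * n + b) = b" using assms by (simp add: bin_digit_def)
  finally show ?thesis
    unfolding digit vdc_eq_sum[OF n] by (simp add: sum_divide_distrib)
qed

lemma vdc_double: "van_der_corput (2 * n) = van_der_corput n / 2"
  using vdc_double_add[of 0 n] by simp

lemma vdc_double_Suc: "van_der_corput (Suc (2 * n)) = van_der_corput n / 2 + 1 / 2"
  using vdc_double_add[of 1 n] by simp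

lemma vdc_0 [simp]: "van_der_corput 0 = 0"
  using vdc_double[of 0] by simp

lemma vdc_range: "0 \<le> van_der_corput n" "van_der_corput n < 1"
proof -
  have "0 \<le> van_der_corput n \<and> van_der_corput n < 1"
  proof (induction n rule: less_induct)
    case (less n)
    show ?case
    proof (cases "n = 0")
      case False
      then have "n div 2 < n" by simp
      moreover have "van_der_corput n = van_der_corput (n div 2) / 2 + real (n mod 2) / 2"
        using vdc_double_add[of "n mod 2" "n div 2"] by simp
      moreover have "real (n mod 2) \<le> 1"
        using mod_less_divisor[of 2 n] by linarith
      ultimately show ?thesis using less[of "n div 2"]  by (simp add: field_simps)
    qed simp
  qed
  then show "0 \<le> van_der_corput n" "van_der_corput n < 1" by auto
qed

section \<open>Signed unnormalised discrepancy of initial intervals\<close>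

definition local_discr :: "nat \<Rightarrow> real \<Rightarrow> real" where
  "local_discr N x = (\<Sum>n<N. of_bool (van_der_corput n < x) - x)"

lemma local_discr_0 [simp]: "local_discr 0 x = 0"
  by (simp add: local_discr_def)

lemma local_discr_Suc:
  "local_discr (Suc N) x = local_discr N x + of_bool (van_der_corput N < x) - x"
  by (simp add: local_discr_def)

lemma sum_lessThan_double:
  fixes g :: "nat \<Rightarrow> 'a::comm_monoid_add"
  shows "sum g {..<2 * N} = (\<Sum>n<N. g (2 * n) + g (Suc (2 * n)))"
  by (induction N) (auto simp: algebra_simps)

text \<open>Odd-indexed points are at least \<open>1 / 2\<close>, so of each pair
  \<open>2 * n\<close>, \<open>2 * n + 1\<close> only the first can lie below \<open>x / 2\<close>.
  In the upper half, treated next, the first always counts and the second decides.\<close>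

lemma local_discr_double_low:
  assumes "x \<le> 1"
  shows "local_discr (2 * N) (x / 2) = local_discr N x"
proof -
  have "\<not> van_der_corput n / 2 + 1 / 2 < x / 2" for n
    using assms vdc_range(1)[of n] by linarith
  then show ?thesis
    unfolding local_discr_def sum_lessThan_double
    by (intro sum.cong) (auto simp: vdc_double vdc_double_Suc)
qed

lemma local_discr_double_high:
  assumes "0 \<le> x"
  shows "local_discr (2 * N) (x / 2 + 1 / 2) = local_discr N x"
proof -
  have "van_der_corput n / 2 < x / 2 + 1 / 2" for n
    using assms vdc_range(2)[of n] by linarith
  then show ?thesis
    unfolding local_discr_def sum_lessThan_double
    by (intro sum.cong) (auto simp: vdc_double vdc_double_Suc)
qed

text \<open>Both odd formulas are shaped like the recursion of \<open>d\<close>. The extra indicator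
  here becomes its complement in the upper half, so for each \<open>x\<close> exactly one half
  yields the full \<open>1 / 2\<close>.\<close>

lemma local_discr_double_Suc_low:
  assumes "x \<le> 1"
  shows "local_discr (Suc (2 * N)) (x / 2)
    = (local_discr N x + local_discr (Suc N) x + of_bool (van_der_corput N < x)) / 2"
  unfolding local_discr_Suc local_discr_double_low[OF assms] vdc_double by (simp add: field_simps)

lemma local_discr_double_Suc_high:
  assumes "0 \<le> x"
  shows "local_discr (Suc (2 * N)) (x / 2 + 1 / 2)
    = (local_discr N x + local_discr (Suc N) x + 1 - of_bool (van_der_corput N < x)) / 2"
proof -
  have "van_der_corput N / 2 < x / 2 + 1 / 2"
    using assms vdc_range(2)[of N] by linarith
  then show ?thesis
    unfolding local_discr_Suc local_discr_double_high[OF assms] vdc_double by (simp add: field_simps)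
qed

text \<open>Every point of \<open>[0, 1]\<close> is the image of some \<open>y\<close> under one of
  the two half maps, so the bounds descend along the binary digits of \<open>N\<close>. The lower
  bound \<open>0\<close> is what later bounds differences of two values by
  \<open>f N\<close>.\<close>

lemma local_discr_bounds:
  fixes f :: "nat \<Rightarrow> real"
  assumes f0: "f 0 = 0"
    and f2: "\<And>n. f (2 * n) = f n"
    and f1: "\<And>n. f (Suc (2 * n)) = (f n + f (Suc n) + 1) / 2"
    and "0 \<le> x" "x \<le> 1"
  shows "0 \<le> local_discr N x \<and> local_discr N x \<le> f N"
  using assms(4,5)
proof (induction N arbitrary: x rule: less_induct)
  case (less N)
  obtain y :: real where y: "0 \<le> y" "y \<le> 1" and xy: "x = y / 2 \<or> x = y / 2 + 1 / 2"
  proof (cases "x \<le> 1 / 2")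
    case True
    then show ?thesis using less.prems by (intro that[of "2 * x"]) auto
  next
    case False
    then show ?thesis using less.prems by (intro that[of "2 * x - 1"]) (auto simp: field_simps)
  qed
  have fS: "f (Suc 0) = 1" using f1[of 0] f0 by simp
  \<comment> \<open>\<open>N = 1\<close> stands apart: with \<open>m = 0\<close> the odd recursion
    would refer back to \<open>Suc m = N\<close>.\<close>
  consider "N = 0" | "N = 1" | m where "N = 2 * m" "m < N" | m where "N = Suc (2 * m)" "Suc m < N"
  proof (cases "even N")
    case True
    then obtain m where "N = 2 * m" by (elim evenE)
    then show ?thesis using that(1,3) by (cases "m = 0") auto
  next
    case False
    then obtain m where "N = Suc (2 * m)" by (metis oddE Suc_eq_plus1)
    then show ?thesis using that(2,4) by (cases "m = 0") auto
  qed
  then show ?case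
  proof cases
    case 1
    then show ?thesis using f0 by simp
  next
    case 2
    then show ?thesis using less.prems fS by (auto simp: local_discr_Suc)
  next
    case (3 m)
    then have "local_discr N x = local_discr m y"
      using xy local_discr_double_low[OF y(2), of m] local_discr_double_high[OF y(1), of m] by metis
    then show ?thesis using less.IH[OF \<open>m < N\<close> y] f2 3 by simp
  next
    case (4 m)
    let ?b = "of_bool (van_der_corput m < y) :: real"
    have "local_discr N x = (local_discr m y + local_discr (Suc m) y + ?b) / 2
       \<or> local_discr N x = (local_discr m y + local_discr (Suc m) y + 1 - ?b) / 2"
      unfolding 4(1)
      using xy local_discr_double_Suc_low[OF y(2), of m] local_discr_double_Suc_high[OF y(1), of m]
      by metis
    moreover have "0 \<le> ?b" "?b \<le> 1" by auto
    moreover have "f N = (f m + f (Suc m) + 1) / 2" unfolding 4(1) by (rule f1)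
    moreover have "m < N" using 4 by simp
    ultimately show ?thesis
      using less.IH[OF \<open>Suc m < N\<close> y] less.IH[OF \<open>m < N\<close> y] by argo
  qed
qed

text \<open>The recursion for the supremum at \<open>2N + 1\<close> needs a point that is nearly optimal for
  \<open>N\<close> and \<open>N + 1\<close> simultaneously; this property passes from \<open>N\<close> to \<open>2N\<close> and to \<open>2N + 1\<close>,
  in both cases with the same new point.\<close>

lemma local_discr_near_max:
  fixes f :: "nat \<Rightarrow> real"
  assumes f0: "f 0 = 0"
    and f2: "\<And>n. f (2 * n) = f n"
    and f1: "\<And>n. f (Suc (2 * n)) = (f n + f (Suc n) + 1) / 2"
    and e: "0 < e" "e \<le> 1"
  shows "\<exists>x. 0 \<le> x \<and> x \<le> 1 \<and> f N - e \<le> local_discr N x \<and> f (Suc N) - e \<le> local_discr (Suc N) x"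
proof (induction N rule: less_induct)
  case (less N)
  show ?case
  proof (cases "N = 0")
    case True
    \<comment> \<open>Here \<open>f 1 = 1\<close>, a supremum approached only as \<open>x\<close>
      decreases to \<open>0\<close>; the point \<open>e\<close> gives exactly
      \<open>1 - e\<close>.\<close>
    then show ?thesis using e f0 f1[of 0] by (intro exI[of _ e]) (auto simp: local_discr_Suc)
  next
    case False
    define m where "m = N div 2"
    have "m < N" using False by (simp add: m_def)
    then obtain y where y: "0 \<le> y" "y \<le> 1" "f m - e \<le> local_discr m y"
        "f (Suc m) - e \<le> local_discr (Suc m) y"
      using less by blast
    \<comment> \<open>The half is chosen so that the indicator term in the odd recursion equals
      \<open>1\<close>.\<close>
    define x where "x = (if van_der_corput m < y then y / 2 else y / 2 + 1 / 2)"
    have x: "0 \<le> x" "x \<le> 1" using y by (auto simp: x_def)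
    have even: "local_discr (2 * m) x = local_discr m y"
      using y by (auto simp: x_def local_discr_double_low local_discr_double_high)
    have even': "local_discr (2 * Suc m) x = local_discr (Suc m) y"
      unfolding x_def using y local_discr_double_low[of y "Suc m"] local_discr_double_high[of y "Suc m"]
      by presburger
    have odd: "local_discr (Suc (2 * m)) x = (local_discr m y + local_discr (Suc m) y + 1) / 2"
      using y by (auto simp: x_def local_discr_double_Suc_low local_discr_double_Suc_high)
    have ge: "f (2 * m) - e \<le> local_discr (2 * m) x"
      "f (Suc (2 * m)) - e \<le> local_discr (Suc (2 * m)) x"
      "f (2 * Suc m) - e \<le> local_discr (2 * Suc m) x"
      unfolding even even' odd f2 f1 using y(3,4) by argo+
    have "N = 2 * m \<or> N = Suc (2 * m)" unfolding m_def by presburger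
    then show ?thesis
    proof
      assume "N = 2 * m"
      then show ?thesis using x ge(1,2) by blast
    next
      assume "N = Suc (2 * m)"
      then have "Suc N = 2 * Suc m" by simp
      with \<open>N = Suc (2 * m)\<close> show ?thesis using x ge(2,3) by metis
    qed
  qed
qed

lemma count_in_local_discr:
  assumes "a \<le> b"
  shows "real (count_in van_der_corput N a b) - real N * (b - a) = local_discr N b - local_discr N a"
proof -
  have "{n. n < N \<and> a \<le> van_der_corput n \<and> van_der_corput n < b}
      = {n \<in> {..<N}. a \<le> van_der_corput n \<and> van_der_corput n < b}" by auto
  then have "real (count_in van_der_corput N a b)
      = (\<Sum>n<N. of_bool (a \<le> van_der_corput n \<and> van_der_corput n < b))"
    unfolding count_in_def by (simp add: sum.If_cases of_bool_def Int_def)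
  also have "\<dots> = (\<Sum>n<N. of_bool (van_der_corput n < b) - of_bool (van_der_corput n < a))"
    using assms by (intro sum.cong) auto
  finally show ?thesis
    by (simp add: local_discr_def sum_subtractf right_diff_distrib)
qed

text \<open>An interval count is a difference of two values in \<open>[0, f N]\<close>, and
  \<open>a = 0\<close> with a nearly maximal \<open>b\<close> comes arbitrarily close to
  \<open>f N\<close>. With \<open>f\<close> arbitrary, an explicit solution of the recursion can be
  substituted later.\<close>

lemma vdc_d_eqI:
  fixes f :: "nat \<Rightarrow> real"
  assumes f0: "f 0 = 0"
    and f2: "\<And>n. f (2 * n) = f n"
    and f1: "\<And>n. f (Suc (2 * n)) = (f n + f (Suc n) + 1) / 2"
  shows "vdc_d N = f N"
proof (cases "N = 0")
  case True
  then show ?thesis using f0 by (simp add: vdc_d_def)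
next
  case False
  let ?I = "{(a::real, b). 0 \<le> a \<and> a \<le> b \<and> b \<le> 1}"
  let ?h = "\<lambda>(a, b). \<bar>real (count_in van_der_corput N a b) / real N - (b - a)\<bar>"
  note bounds = local_discr_bounds[of f, OF f0 f2 f1]
  have h: "?h (a, b) = \<bar>local_discr N b - local_discr N a\<bar> / real N" if "a \<le> b" for a b
  proof -
    have "real (count_in van_der_corput N a b) / real N - (b - a)
        = (local_discr N b - local_discr N a) / real N"
      using False unfolding count_in_local_discr[OF that, of N, symmetric]
      by (simp add: diff_divide_distrib)
    then show ?thesis by (simp add: abs_divide)
  qed
  have ub: "?h p \<le> f N / real N" if "p \<in> ?I" for p
  proof -
    obtain a b where p: "p = (a, b)" by (cases p)
    then have ab: "0 \<le> a" "a \<le> b" "b \<le> 1" using that by auto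
    have "\<bar>local_discr N b - local_discr N a\<bar> \<le> f N"
      using bounds[of a N] bounds[of b N] ab by auto
    then show ?thesis unfolding p h[OF ab(2)] by (rule divide_right_mono) simp
  qed
  have "(SUP p \<in> ?I. ?h p) = f N / real N"
  proof (rule antisym)
    show "(SUP p \<in> ?I. ?h p) \<le> f N / real N"
      by (rule cSUP_least) (use ub in \<open>auto intro!: exI[of _ 0]\<close>)
    show "f N / real N \<le> (SUP p \<in> ?I. ?h p)"
    proof (rule field_le_epsilon)
      fix e :: real assume "0 < e"
      then obtain x where x: "0 \<le> x" "x \<le> 1" "f N - min e 1 \<le> local_discr N x"
        using local_discr_near_max[of f "min e 1" N, OF f0 f2 f1] by auto
      have z: "local_discr N 0 = 0"
        using vdc_range(1) by (simp add: local_discr_def not_less[symmetric])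
      have "f N - e \<le> \<bar>local_discr N x - local_discr N 0\<bar>"
        using x z by linarith
      then have "(f N - e) / real N \<le> ?h (0, x)"
        unfolding h[OF x(1)] by (rule divide_right_mono) simp
      also have "\<dots> \<le> (SUP p \<in> ?I. ?h p)"
        by (rule cSUP_upper[OF _ bdd_above_discrepancy]) (use x in auto)
      finally have "f N / real N \<le> (SUP p \<in> ?I. ?h p) + e / real N"
        by (simp add: diff_divide_distrib)
      also have "e / real N \<le> e" using False \<open>0 < e\<close> by (simp add: divide_le_eq)
      finally show "f N / real N \<le> (SUP p \<in> ?I. ?h p) + e" by simp
    qed
  qed
  then show ?thesis using False by (simp add: vdc_d_def discrepancy_def)
qed

subsection \<open>Sums of distances to the nearest integer\<close>

definition nint_dist :: "real \<Rightarrow> real" where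
  "nint_dist y = \<bar>y - of_int (round y)\<bar>"

lemma nint_dist_le: "nint_dist y \<le> \<bar>y - of_int m\<bar>"
  unfolding nint_dist_def by (rule round_diff_minimal)

lemma nint_dist_range: "0 \<le> nint_dist y" "nint_dist y \<le> 1 / 2"
  using of_int_round_abs_le[of y] by (auto simp: nint_dist_def abs_minus_commute)

lemma nint_dist_lipschitz: "\<bar>nint_dist x - nint_dist y\<bar> \<le> \<bar>x - y\<bar>"
proof -
  have "nint_dist x \<le> \<bar>x - y\<bar> + nint_dist y" for x y
    using nint_dist_le[of x "round y"] unfolding nint_dist_def[of y] by linarith
  from this[of x y] this[of y x] show ?thesis by linarith
qed

text \<open>Any other integer is at distance at least \<open>1\<close> from \<open>m\<close>, so it
  is no closer to \<open>y\<close>; at a tie both candidates give the same distance.\<close>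

lemma nint_dist_eqI:
  assumes "\<bar>y - of_int m\<bar> \<le> 1 / 2"
  shows "nint_dist y = \<bar>y - of_int m\<bar>"
proof (rule antisym[OF nint_dist_le])
  have "\<bar>y - of_int m\<bar> \<le> \<bar>y - of_int k\<bar>" for k
  proof (cases "k = m")
    case False
    then have "1 \<le> \<bar>of_int k - of_int m :: real\<bar>" by linarith
    then show ?thesis using assms by linarith
  qed simp
  then show "\<bar>y - of_int m\<bar> \<le> nint_dist y" unfolding nint_dist_def .
qed

lemma nint_dist_of_nat [simp]: "nint_dist (real n) = 0"
  using nint_dist_eqI[of "real n" "int n"] by simp

lemma nint_dist_zero [simp]: "nint_dist 0 = 0"
  using nint_dist_of_nat[of 0] by simp

lemma continuous_on_nint_dist [continuous_intros]:
  assumes "continuous_on A g"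
  shows "continuous_on A (\<lambda>x. nint_dist (g x))"
proof -
  have "1-lipschitz_on UNIV nint_dist"
    by (rule lipschitz_onI) (use nint_dist_lipschitz in \<open>auto simp: dist_real_def\<close>)
  then have "continuous_on UNIV nint_dist" by (rule lipschitz_on_continuous_on)
  then show ?thesis using assms by (rule continuous_on_compose2) auto
qed

text \<open>\<open>y / 4 + nint_osc y\<close> is the primitive of \<^const>\<open>nint_dist\<close> vanishing at \<open>0\<close>, and
  \<open>nint_osc\<close> is its \<open>1\<close>-periodic part. On each half period \<open>nint_osc\<close> is a parabola
  centred at an odd multiple of \<open>1 / 4\<close>, and \<open>1 / 4 - \<bar>r\<bar>\<close> is the distance to that centre.\<close>

definition nint_osc :: "real \<Rightarrow> real" where
  "nint_osc y = (let r = nint_dist (y + 1 / 4) - 1 / 4 in r * \<bar>r\<bar> / 2 - r / 4)"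

definition nint_prim :: "real \<Rightarrow> real" where
  "nint_prim y = y / 4 + nint_osc y"

lemma nint_osc_bound: "\<bar>nint_osc y\<bar> \<le> 1 / 8"
proof -
  define r where "r = nint_dist (y + 1 / 4) - 1 / 4"
  have r: "\<bar>r\<bar> \<le> 1 / 4" using nint_dist_range[of "y + 1 / 4"] unfolding r_def by linarith
  have "\<bar>r * \<bar>r\<bar>\<bar> \<le> 1 / 4 * (1 / 4)"
    unfolding abs_mult abs_abs by (rule mult_mono) (use r in auto)
  then show ?thesis using r unfolding nint_osc_def Let_def r_def[symmetric] by linarith
qed

lemma continuous_on_nint_osc [continuous_intros]:
  assumes "continuous_on A g"
  shows "continuous_on A (\<lambda>x. nint_osc (g x))"
  unfolding nint_osc_def Let_def by (intro continuous_intros assms) auto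

lemma nint_osc_low:
  assumes "0 \<le> t" "t \<le> 1 / 2"
  shows "nint_osc (of_int n + t) = t\<^sup>2 / 2 - t / 4"
\<comment> \<open>At the centre \<open>t = 1 / 4\<close> of the parabola the integer nearest to the
  shifted argument changes from \<open>n\<close> to \<open>n + 1\<close>.\<close>
proof (cases "t \<le> 1 / 4")
  case True
  then have "nint_dist (of_int n + t + 1 / 4) = t + 1 / 4"
    using nint_dist_eqI[of "of_int n + t + 1 / 4" n] assms by simp
  then show ?thesis using assms by (simp add: nint_osc_def power2_eq_square)
next
  case False
  then have "nint_dist (of_int n + t + 1 / 4) = 3 / 4 - t"
    using nint_dist_eqI[of "of_int n + t + 1 / 4" "n + 1"] assms by simp
  then have "nint_osc (of_int n + t) = (1 / 2 - t) * \<bar>1 / 2 - t\<bar> / 2 - (1 / 2 - t) / 4"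
    by (simp add: nint_osc_def Let_def add_ac)
  also have "\<bar>1 / 2 - t\<bar> = 1 / 2 - t" using assms by simp
  finally show ?thesis by (simp add: power2_eq_square field_simps)
qed

lemma nint_osc_high:
  assumes "0 \<le> t" "t \<le> 1 / 2"
  shows "nint_osc (of_int n + 1 / 2 + t) = t / 4 - t\<^sup>2 / 2"
proof (cases "t \<le> 1 / 4")
  case True
  then have "nint_dist (of_int n + 1 / 2 + t + 1 / 4) = 1 / 4 - t"
    using nint_dist_eqI[of "of_int n + 1 / 2 + t + 1 / 4" "n + 1"] assms by simp
  then show ?thesis using assms by (simp add: nint_osc_def power2_eq_square)
next
  case False
  then have "nint_dist (of_int n + 1 / 2 + t + 1 / 4) = t - 1 / 4"
    using nint_dist_eqI[of "of_int n + 1 / 2 + t + 1 / 4" "n + 1"] assms by simp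
  then have "nint_osc (of_int n + 1 / 2 + t) = (t - 1 / 2) * \<bar>t - 1 / 2\<bar> / 2 - (t - 1 / 2) / 4"
    by (simp add: nint_osc_def Let_def add_ac)
  also have "\<bar>t - 1 / 2\<bar> = 1 / 2 - t" using assms by simp
  finally show ?thesis by (simp add: power2_eq_square field_simps)
qed

lemma nint_osc_of_nat [simp]: "nint_osc (real n) = 0"
  using nint_osc_low[of 0 "int n"] by simp

text \<open>On a cell between consecutive half-integers \<open>nint_dist\<close> is affine; the
  parity of \<open>q\<close> decides between its rising and falling branch.\<close>

lemma half_cell_cases:
  fixes q :: int
  assumes "of_int q / 2 \<le> x" "y \<le> (of_int q + 1) / 2" "x \<le> (y :: real)"
  obtains (low) n t u where "x = of_int n + t" "y = of_int n + u" "0 \<le> t" "t \<le> u" "u \<le> 1 / 2"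
  | (high) n t u where "x = of_int n + 1 / 2 + t" "y = of_int n + 1 / 2 + u"
      "0 \<le> t" "t \<le> u" "u \<le> 1 / 2"
proof (cases "even q")
  case True
  then obtain n where "q = 2 * n" by (elim evenE)
  then show ?thesis using assms by (intro low[of n "x - of_int n" "y - of_int n"]) auto
next
  case False
  then obtain n where "q = 2 * n + 1" by (elim oddE)
  then show ?thesis
    using assms by (intro high[of n "x - of_int n - 1/2" "y - of_int n - 1/2"]) (auto simp: field_simps)
qed

lemma nint_dist_low:
  assumes "0 \<le> t" "t \<le> 1 / 2"
  shows "nint_dist (of_int n + t) = t"
  using nint_dist_eqI[of "of_int n + t" n] assms by simp

lemma nint_dist_high:
  assumes "0 \<le> t" "t \<le> 1 / 2"
  shows "nint_dist (of_int n + 1 / 2 + t) = 1 / 2 - t"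
  using nint_dist_eqI[of "of_int n + 1 / 2 + t" "n + 1"] assms by simp

lemma nint_dist_midpoint:
  fixes q :: int
  assumes "of_int q / 2 \<le> x" "y \<le> (of_int q + 1) / 2" "x \<le> (y :: real)"
  shows "nint_dist ((x + y) / 2) = (nint_dist x + nint_dist y) / 2"
  using assms
proof (cases rule: half_cell_cases)
  case (low n t u)
  then have "(x + y) / 2 = of_int n + (t + u) / 2" by (simp add: field_simps)
  moreover have "nint_dist (of_int n + (t + u) / 2) = (t + u) / 2"
    using low by (intro nint_dist_low) auto
  ultimately have "nint_dist ((x + y) / 2) = (t + u) / 2" by (simp only:)
  then show ?thesis using low by (simp add: nint_dist_low)
next
  case (high n t u)
  then have "(x + y) / 2 = of_int n + 1 / 2 + (t + u) / 2" by (simp add: field_simps)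
  moreover have "nint_dist (of_int n + 1 / 2 + (t + u) / 2) = 1 / 2 - (t + u) / 2"
    using high by (intro nint_dist_high) auto
  moreover have "nint_dist x = 1 / 2 - t" "nint_dist y = 1 / 2 - u"
    using high nint_dist_high[of t n] nint_dist_high[of u n] by auto
  ultimately show ?thesis by (simp only:) (simp add: field_simps)
qed

text \<open>The trapezoidal rule is exact for the affine integrand on a half cell.\<close>

lemma nint_prim_trapezoid:
  fixes q :: int
  assumes "of_int q / 2 \<le> x" "y \<le> (of_int q + 1) / 2" "x \<le> (y :: real)"
  shows "nint_prim y - nint_prim x = (y - x) * (nint_dist x + nint_dist y) / 2"
  using assms
proof (cases rule: half_cell_cases)
  case (low n t u)
  then show ?thesis
    unfolding nint_prim_def low(1,2)
    by (simp add: nint_dist_low nint_osc_low del: of_int_add)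
      (simp add: power2_eq_square field_simps)
next
  case (high n t u)
  have eqs: "nint_dist x = 1 / 2 - t" "nint_dist y = 1 / 2 - u"
    "nint_osc x = t / 4 - t\<^sup>2 / 2" "nint_osc y = u / 4 - u\<^sup>2 / 2"
    unfolding high(1,2) by (rule nint_dist_high nint_osc_high; use high in simp)+
  have "nint_prim y - nint_prim x = (y - x) / 4 + nint_osc y - nint_osc x"
    by (simp add: nint_prim_def field_simps)
  moreover have "y - x = u - t" using high by simp
  ultimately show ?thesis
    unfolding eqs by (simp only:) (simp add: power2_eq_square field_simps)
qed

text \<open>Near \<open>0\<close> the linear terms cancel and leave \<open>y^2 / 2\<close>; this
  quadratic decay makes the series of \<open>2^i P(x / 2^i)\<close> converge.\<close>

lemma nint_prim_bound:
  assumes "0 \<le> y"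
  shows "\<bar>nint_prim y\<bar> \<le> y\<^sup>2"
proof (cases "y \<le> 1 / 2")
  case True
  then show ?thesis using nint_osc_low[of y 0] assms by (simp add: nint_prim_def)
next
  case False
  \<comment> \<open>The product expands to \<open>y^2 - (y / 4 + 1 / 8)\<close>, and
    \<open>1 / 8\<close> is the bound on \<open>nint_osc\<close>.\<close>
  then have "0 \<le> (y - 1 / 2) * (y + 1 / 4)" using assms by (intro mult_nonneg_nonneg) auto
  then have "y / 4 + 1 / 8 \<le> y\<^sup>2" by (simp add: power2_eq_square field_simps)
  then show ?thesis using nint_osc_bound[of y] assms unfolding nint_prim_def by linarith
qed

text \<open>Scaled by \<open>2 ^ Suc i\<close>, the cell ends are multiples of \<open>2 ^ i\<close>,
  and none of these lies strictly between \<open>N\<close> and \<open>N + 1\<close>.\<close>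

lemma dyadic_half_cell:
  obtains q :: int where "of_int q / 2 \<le> real N / 2 ^ Suc i" "real (Suc N) / 2 ^ Suc i \<le> (of_int q + 1) / 2"
proof
  let ?q = "N div 2 ^ i"
  have "?q * 2 ^ i \<le> N" by (rule div_times_less_eq_dividend)
  then have "real (?q * 2 ^ i) \<le> real N" by (simp only: of_nat_le_iff)
  then show "of_int (int ?q) / 2 \<le> real N / 2 ^ Suc i"
    by (simp add: field_simps)
  have "Suc N \<le> (?q + 1) * 2 ^ i"
    using dividend_less_div_times[of "2 ^ i" N] by (simp add: Suc_le_eq)
  then have "real (Suc N) \<le> real ((?q + 1) * 2 ^ i)" by (simp only: of_nat_le_iff)
  then show "real (Suc N) / 2 ^ Suc i \<le> (of_int (int ?q) + 1) / 2"
    by (simp add: field_simps)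
qed

section \<open>An explicit solution of the recursion\<close>

definition dist_sum :: "nat \<Rightarrow> real" where
  "dist_sum N = (\<Sum>i. nint_dist (real N / 2 ^ Suc i))"

lemma summable_nint_dist: "summable (\<lambda>i. nint_dist (x / 2 ^ Suc i))"
proof (rule summable_comparison_test')
  show "summable (\<lambda>i. \<bar>x\<bar> / 2 * (1 / 2) ^ i)"
    by (intro summable_mult summable_geometric) simp
  show "norm (nint_dist (x / 2 ^ Suc i)) \<le> \<bar>x\<bar> / 2 * (1 / 2) ^ i" for i
    using nint_dist_le[of "x / 2 ^ Suc i" 0] nint_dist_range(1)[of "x / 2 ^ Suc i"]
    by (simp add: abs_divide abs_mult power_one_over field_simps)
qed

lemma dist_sum_0: "dist_sum 0 = 0"
  by (simp add: dist_sum_def)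

lemma dist_sum_double: "dist_sum (2 * N) = dist_sum N"
proof -
  have "dist_sum (2 * N) = nint_dist (real (2 * N) / 2 ^ Suc 0)
      + (\<Sum>i. nint_dist (real (2 * N) / 2 ^ Suc (Suc i)))"
    unfolding dist_sum_def using suminf_split_head[OF summable_nint_dist[of "real (2 * N)"]] by simp
  then show ?thesis by (simp add: dist_sum_def)
qed

text \<open>The head term is the distance of a half-integer, \<open>1 / 2\<close>; each later
  argument is the midpoint of the arguments for \<open>N\<close> and \<open>N + 1\<close>, which
  share a half cell.\<close>

lemma dist_sum_double_Suc:
  "dist_sum (Suc (2 * N)) = (dist_sum N + dist_sum (Suc N) + 1) / 2"
proof -
  have mid: "nint_dist (real (Suc (2 * N)) / 2 ^ Suc (Suc i))
      = (nint_dist (real N / 2 ^ Suc i) + nint_dist (real (Suc N) / 2 ^ Suc i)) / 2" for i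
  proof -
    obtain q :: int where q: "of_int q / 2 \<le> real N / 2 ^ Suc i"
        "real (Suc N) / 2 ^ Suc i \<le> (of_int q + 1) / 2"
      by (rule dyadic_half_cell)
    have "real N / 2 ^ Suc i \<le> real (Suc N) / 2 ^ Suc i" by (intro divide_right_mono) auto
    from nint_dist_midpoint[OF q this] show ?thesis by (simp add: field_simps)
  qed
  have half: "nint_dist (real (Suc (2 * N)) / 2 ^ Suc 0) = 1 / 2"
    using nint_dist_low[of "1 / 2" "int N"] by (simp add: field_simps)
  have "dist_sum (Suc (2 * N)) = 1 / 2
      + (\<Sum>i. nint_dist (real (Suc (2 * N)) / 2 ^ Suc (Suc i)))"
    unfolding dist_sum_def
    using suminf_split_head[OF summable_nint_dist[of "real (Suc (2 * N))"]] half by simp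
  also have "(\<Sum>i. nint_dist (real (Suc (2 * N)) / 2 ^ Suc (Suc i)))
      = (dist_sum N + dist_sum (Suc N)) / 2"
    unfolding mid dist_sum_def
    by (simp only: suminf_divide suminf_add summable_nint_dist summable_add)
  finally show ?thesis by simp
qed

section \<open>The continuous extension of the trapezoidal sums and its scaling law\<close>

definition low_sum :: "real \<Rightarrow> real" where
  "low_sum x = (\<Sum>i. 2 ^ Suc i * nint_prim (x / 2 ^ Suc i))"

definition high_sum :: "real \<Rightarrow> real" where
  "high_sum x = (\<Sum>i. nint_osc (2 ^ i * x) / 2 ^ i)"

text \<open>The separate \<open>M\<close> makes the bound uniform on \<open>[0, M]\<close>, as the
  Weierstrass test requires.\<close>

lemma low_sum_term_bound:
  assumes "0 \<le> x" "x \<le> M"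
  shows "norm (2 ^ Suc i * nint_prim (x / 2 ^ Suc i)) \<le> M\<^sup>2 / 2 * (1 / 2) ^ i"
proof -
  have "norm (2 ^ Suc i * nint_prim (x / 2 ^ Suc i)) \<le> 2 ^ Suc i * (x / 2 ^ Suc i)\<^sup>2"
    using nint_prim_bound[of "x / 2 ^ Suc i"] assms by (simp add: abs_mult)
  also have "\<dots> = x\<^sup>2 / 2 * (1 / 2) ^ i"
    by (simp add: power2_eq_square power_one_over field_simps)
  also have "\<dots> \<le> M\<^sup>2 / 2 * (1 / 2) ^ i"
    using assms by (intro mult_right_mono divide_right_mono power_mono) auto
  finally show ?thesis .
qed

lemma high_sum_term_bound: "norm (nint_osc (2 ^ i * x) / 2 ^ i) \<le> 1 / 8 * (1 / 2) ^ i"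
  using divide_right_mono[OF nint_osc_bound[of "2 ^ i * x"], of "2 ^ i"]
  by (simp add: abs_divide power_one_over)

lemma summable_half_power: "summable (\<lambda>i. c * (1 / 2 :: real) ^ i)"
  by (intro summable_mult summable_geometric) simp

lemma summable_low_sum:
  assumes "0 \<le> x"
  shows "summable (\<lambda>i. 2 ^ Suc i * nint_prim (x / 2 ^ Suc i))"
  using summable_half_power low_sum_term_bound[OF assms order_refl]
  by (rule summable_comparison_test')

lemma summable_high_sum: "summable (\<lambda>i. nint_osc (2 ^ i * x) / 2 ^ i)"
  using summable_half_power high_sum_term_bound by (rule summable_comparison_test')

lemma continuous_on_suminf_half_power:
  fixes g :: "nat \<Rightarrow> real \<Rightarrow> real"
  assumes "\<And>i. continuous_on A (g i)"
    and "\<And>i x. x \<in> A \<Longrightarrow> norm (g i x) \<le> c * (1 / 2) ^ i"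
  shows "continuous_on A (\<lambda>x. \<Sum>i. g i x)"
proof (rule uniform_limit_theorem)
  show "uniform_limit A (\<lambda>n x. \<Sum>i<n. g i x) (\<lambda>x. \<Sum>i. g i x) sequentially"
    by (rule Weierstrass_m_test[OF assms(2) summable_half_power])
  show "\<forall>\<^sub>F n in sequentially. continuous_on A (\<lambda>x. \<Sum>i<n. g i x)"
    by (intro always_eventually allI continuous_on_sum assms(1))
qed simp

lemma continuous_on_low_sum: "continuous_on {0..M} low_sum"
  unfolding low_sum_def nint_prim_def
  by (rule continuous_on_suminf_half_power[where c = "M\<^sup>2 / 2"])
    (use low_sum_term_bound in \<open>auto simp: nint_prim_def intro!: continuous_intros\<close>)

lemma continuous_on_high_sum: "continuous_on A high_sum"
  unfolding high_sum_def
  by (rule continuous_on_suminf_half_power[OF _ high_sum_term_bound]) (intro continuous_intros, simp)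

definition lin_growth :: "real \<Rightarrow> real" where
  "lin_growth x = low_sum x + high_sum x"

text \<open>Doubling shifts both series by one index: \<open>low_sum\<close> gains
  \<open>2 * nint_prim x\<close> and \<open>high_sum\<close> loses \<open>2 * nint_osc x\<close>,
  beyond the factor \<open>2\<close>. The oscillating parts cancel, leaving
  \<open>x / 2\<close>.\<close>

lemma lin_growth_double:
  assumes "0 \<le> x"
  shows "lin_growth (2 * x) = 2 * lin_growth x + x / 2"
proof -
  have "low_sum (2 * x) = 2 * nint_prim x
      + (\<Sum>i. 2 ^ Suc (Suc i) * nint_prim (2 * x / 2 ^ Suc (Suc i)))"
    unfolding low_sum_def using suminf_split_head[OF summable_low_sum[of "2 * x"]] assms by simp
  also have "(\<Sum>i. 2 ^ Suc (Suc i) * nint_prim (2 * x / 2 ^ Suc (Suc i)))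
      = (\<Sum>i. 2 * (2 ^ Suc i * nint_prim (x / 2 ^ Suc i)))"
    by (simp add: mult.assoc)
  also have "\<dots> = 2 * low_sum x"
    unfolding low_sum_def by (rule suminf_mult[OF summable_low_sum[OF assms]])
  finally have L: "low_sum (2 * x) = 2 * nint_prim x + 2 * low_sum x" .
  have "high_sum x = nint_osc x + (\<Sum>i. nint_osc (2 ^ Suc i * x) / 2 ^ Suc i)"
    unfolding high_sum_def using suminf_split_head[OF summable_high_sum[of x]] by simp
  also have "(\<Sum>i. nint_osc (2 ^ Suc i * x) / 2 ^ Suc i)
      = (\<Sum>i. nint_osc (2 ^ i * (2 * x)) / 2 ^ i / 2)"
    by (simp add: mult_ac)
  also have "\<dots> = high_sum (2 * x) / 2"
    unfolding high_sum_def by (rule suminf_divide[OF summable_high_sum])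
  finally show ?thesis using L by (simp add: lin_growth_def nint_prim_def)
qed

lemma lin_growth_of_nat: "lin_growth (real N) = low_sum (real N)"
proof -
  have "nint_osc (2 ^ i * real N) = 0" for i
    using nint_osc_of_nat[of "2 ^ i * N"] by simp
  then show ?thesis by (simp add: lin_growth_def high_sum_def)
qed

text \<open>Each term of \<open>low_sum\<close> grows by one exact trapezoid, whose width
  \<open>1 / 2 ^ Suc i\<close> cancels the factor in front.\<close>

lemma lin_growth_Suc:
  "lin_growth (real (Suc N)) = lin_growth (real N) + (dist_sum N + dist_sum (Suc N)) / 2"
proof -
  have step: "2 ^ Suc i * nint_prim (real (Suc N) / 2 ^ Suc i) - 2 ^ Suc i * nint_prim (real N / 2 ^ Suc i)
      = (nint_dist (real N / 2 ^ Suc i) + nint_dist (real (Suc N) / 2 ^ Suc i)) / 2" for i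
  proof -
    obtain q :: int where q: "of_int q / 2 \<le> real N / 2 ^ Suc i"
        "real (Suc N) / 2 ^ Suc i \<le> (of_int q + 1) / 2"
      by (rule dyadic_half_cell)
    have le: "real N / 2 ^ Suc i \<le> real (Suc N) / 2 ^ Suc i" by (intro divide_right_mono) auto
    have width: "2 ^ Suc i * (real (Suc N) / 2 ^ Suc i - real N / 2 ^ Suc i) = 1"
      by (simp add: field_simps)
    show ?thesis
      unfolding right_diff_distrib[symmetric] nint_prim_trapezoid[OF q le]
      using width by (metis mult.assoc mult_1 times_divide_eq_right)
  qed
  have "low_sum (real (Suc N)) - low_sum (real N) = (dist_sum N + dist_sum (Suc N)) / 2"
    unfolding low_sum_def dist_sum_def
    by (subst suminf_diff) (simp_all only: step suminf_divide suminf_add summable_nint_dist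
        summable_add summable_low_sum of_nat_0_le_iff)
  then show ?thesis unfolding lin_growth_of_nat by argo
qed

text \<open>Adding up trapezoids leaves half weights only at the two ends, and the end
  \<open>0\<close> contributes \<open>0\<close>.\<close>

lemma lin_growth_eq_sum:
  "lin_growth (real N) = (\<Sum>k = 1..N. dist_sum k) - dist_sum N / 2"
proof (induction N)
  case 0
  have "nint_prim 0 = 0" using nint_prim_bound[of 0] by simp
  then show ?case using lin_growth_of_nat[of 0] by (simp add: low_sum_def dist_sum_0)
next
  case (Suc N)
  then show ?case unfolding lin_growth_Suc by (simp add: field_simps)
qed

lemma continuous_on_lin_growth_powr: "continuous_on UNIV (\<lambda>t. lin_growth (2 powr t))"
proof -
  have "continuous_on {..<M} (\<lambda>t. lin_growth (2 powr t))" for M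
  proof -
    have "continuous_on {0..2 powr M} lin_growth"
      unfolding lin_growth_def
      by (intro continuous_intros continuous_on_low_sum continuous_on_high_sum)
    moreover have "continuous_on {..<M} (\<lambda>t. 2 powr t :: real)"
      by (intro continuous_intros) auto
    ultimately show ?thesis by (rule continuous_on_compose2) auto
  qed
  \<comment> \<open>Continuity of \<open>low_sum\<close> is available on bounded intervals only, so
    the line is covered by open rays, each mapped by the exponential into one such interval.\<close>
  then have "continuous_on (\<Union>M. {..<M}) (\<lambda>t. lin_growth (2 powr t))"
    by (intro continuous_on_open_UN) auto
  moreover have "(\<Union>M. {..<M :: real}) = UNIV" using lt_ex gt_ex by auto
  ultimately show ?thesis by simp
qed

section \<open>Uniqueness by density of the logarithms modulo \<open>1\<close>\<close>

lemma periodic_eq_of_log_nat: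
  fixes \<phi> \<psi> :: "real \<Rightarrow> real"
  assumes cont: "continuous_on UNIV \<phi>" "continuous_on UNIV \<psi>"
    and per: "\<And>t. \<phi> (t + 1) = \<phi> t" "\<And>t. \<psi> (t + 1) = \<psi> t"
    and eq: "\<And>N. 1 \<le> N \<Longrightarrow> \<phi> (log 2 (real N)) = \<psi> (log 2 (real N))"
  shows "\<phi> = \<psi>"
proof
  fix t
  define D where "D = (\<lambda>t. \<phi> t - \<psi> t)"
  have D_shift: "D (s + real k) = D s" for s k
  proof (induction k)
    case (Suc k)
    have "D (s + real k + 1) = D (s + real k)" unfolding D_def per ..
    with Suc show ?case by (simp add: add_ac)
  qed simp
  \<comment> \<open>Rounding \<open>2 powr (t + k)\<close> up changes it by at most
    \<open>1\<close>, a relative error that vanishes as \<open>k\<close> grows; hence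
    \<open>log 2 (N k) - k\<close> tends to \<open>t\<close>.\<close>
  define N where "N k = nat \<lceil>2 powr (t + real k)\<rceil>" for k
  define s where "s k = log 2 (real (N k)) - real k" for k
  have pos: "0 < (2::real) powr (t + real k)" for k by simp
  have N1: "2 powr (t + real k) \<le> real (N k)" "real (N k) \<le> 2 powr (t + real k) + 1" for k
    unfolding N_def using pos[of k] by linarith+
  have N_ge1: "1 \<le> N k" for k using N1(1)[of k] pos[of k] by (cases "N k") auto
  have D_s: "D (s k) = 0" for k
    using D_shift[of "s k" k] eq[OF N_ge1] by (simp add: s_def D_def)
  have "s \<longlonglongrightarrow> t"
  proof (rule tendsto_sandwich)
    show "\<forall>\<^sub>F k in sequentially. t \<le> s k"
    proof (intro always_eventually allI)
      fix k
      have "t + real k \<le> log 2 (real (N k))"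
        using N1(1)[of k] N_ge1[of k] by (subst le_log_iff) auto
      then show "t \<le> s k" by (simp add: s_def)
    qed
    show "\<forall>\<^sub>F k in sequentially. s k \<le> log 2 (2 powr t + (1 / 2) ^ k)"
    proof (intro always_eventually allI)
      fix k
      have "log 2 (real (N k)) \<le> log 2 (2 powr (t + real k) + 1)"
        using N1(2)[of k] N_ge1[of k] by (subst log_le_cancel_iff) auto
      also have "2 powr (t + real k) + 1 = (2 powr t + (1 / 2) ^ k) * 2 powr real k"
        by (simp add: powr_add powr_realpow power_one_over field_simps)
      also have "log 2 \<dots> = log 2 (2 powr t + (1 / 2) ^ k) + real k"
        by (subst log_mult) (auto simp: add_pos_pos powr_gt_zero less_imp_neq[symmetric])
      finally show "s k \<le> log 2 (2 powr t + (1 / 2) ^ k)" by (simp add: s_def)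
    qed
    have "(\<lambda>k. log 2 (2 powr t + (1 / 2) ^ k)) \<longlonglongrightarrow> log 2 (2 powr t + 0)"
      by (intro tendsto_intros LIMSEQ_power_zero) auto
    then show "(\<lambda>k. log 2 (2 powr t + (1 / 2) ^ k)) \<longlonglongrightarrow> t" by simp
  qed simp
  moreover have "isCont D t"
    using cont unfolding D_def continuous_on_eq_continuous_at[OF open_UNIV]
    by (intro continuous_intros) auto
  ultimately have "(\<lambda>k. D (s k)) \<longlonglongrightarrow> D t" by (rule isCont_tendsto_compose[rotated])
  then have "D t = 0" unfolding D_s by (simp add: LIMSEQ_const_iff)
  then show "\<phi> t = \<psi> t" by (simp add: D_def)
qed

section \<open>Identification with the discrepancy and conclusion\<close>

lemma vdc_d_eq_dist_sum: "vdc_d N = dist_sum N"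
  by (intro vdc_d_eqI dist_sum_0 dist_sum_double dist_sum_double_Suc)

lemma vdc_S_eq_lin_growth: "vdc_S N = lin_growth (real N) + vdc_d N / 2"
  by (simp add: vdc_S_def vdc_d_eq_dist_sum lin_growth_eq_sum)

theorem theorem2p3:
  shows "\<exists>!\<psi> :: real \<Rightarrow> real.
    continuous_on UNIV \<psi> \<and>
    (\<forall>t. \<psi> (t + 1) = \<psi> t) \<and>
    (\<forall>N :: nat. N \<ge> 1 \<longrightarrow>
      1 / real N * vdc_S N
        = log 2 (real N) / 4 + vdc_d N / (2 * real N) + \<psi> (log 2 (real N)))"
proof (rule ex_ex1I)
  define \<psi> where "\<psi> t = lin_growth (2 powr t) / 2 powr t - t / 4" for t :: real
  have "continuous_on UNIV \<psi>"
    unfolding \<psi>_def by (intro continuous_intros continuous_on_lin_growth_powr) auto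
  moreover have "\<psi> (t + 1) = \<psi> t" for t
  proof -
    have "2 powr (t + 1) = 2 * 2 powr t" by (simp add: powr_add)
    \<comment> \<open>With \<open>x = 2 powr t\<close>, the term \<open>x / 2\<close> of the
      doubling law divided by \<open>2 * x\<close> is \<open>1 / 4\<close>, exactly the increase of
      \<open>t / 4\<close>.\<close>
    then show ?thesis
      unfolding \<psi>_def by (simp add: lin_growth_double field_simps)
  qed
  moreover have "1 / real N * vdc_S N
        = log 2 (real N) / 4 + vdc_d N / (2 * real N) + \<psi> (log 2 (real N))" if "N \<ge> 1" for N
  proof -
    have "2 powr log 2 (real N) = real N" using that by simp
    then show ?thesis
      using that unfolding \<psi>_def vdc_S_eq_lin_growth by (simp add: field_simps)
  qed
  ultimately show "\<exists>\<psi>. continuous_on UNIV \<psi> \<and> (\<forall>t. \<psi> (t + 1) = \<psi> t) \<and>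
    (\<forall>N :: nat. N \<ge> 1 \<longrightarrow>
      1 / real N * vdc_S N
        = log 2 (real N) / 4 + vdc_d N / (2 * real N) + \<psi> (log 2 (real N)))"
    by (intro exI[of _ \<psi>]) blast
next
  fix \<phi> \<psi> :: "real \<Rightarrow> real"
  assume \<phi>: "continuous_on UNIV \<phi> \<and> (\<forall>t. \<phi> (t + 1) = \<phi> t) \<and>
    (\<forall>N :: nat. N \<ge> 1 \<longrightarrow>
      1 / real N * vdc_S N
        = log 2 (real N) / 4 + vdc_d N / (2 * real N) + \<phi> (log 2 (real N)))"
    and \<psi>: "continuous_on UNIV \<psi> \<and> (\<forall>t. \<psi> (t + 1) = \<psi> t) \<and>
    (\<forall>N :: nat. N \<ge> 1 \<longrightarrow>
      1 / real N * vdc_S N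
        = log 2 (real N) / 4 + vdc_d N / (2 * real N) + \<psi> (log 2 (real N)))"
  show "\<phi> = \<psi>"
  proof (rule periodic_eq_of_log_nat)
    show "\<phi> (log 2 (real N)) = \<psi> (log 2 (real N))" if "1 \<le> N" for N
      using \<phi> \<psi> that by (metis add_left_cancel)
  qed (use \<phi> \<psi> in auto)
qed

end
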